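(* Let $N=\bigoplus_{1\le i\le r}F[-\bar\delta_i]/M$ be a finitely generated multigraded right $F$-module, where $\bar\delta_1,\ldots,\bar\delta_r\in\mathbb{N}^n$ and $M\subset\bigoplus_{1\le i\le r}F[-\bar\delta_i]$ is a multigraded right submodule. Fix any monomial ordering of the free right module $F^r$ and let $N'=\bigoplus_{1\le i\le r}F[-\bar\delta_i]/\mathrm{LM}(M)$. Then $\mathrm{HF}(N)=\mathrm{HF}(N')$, and hence $\mathrm{HS}(N)=\mathrm{HS}(N')$.
   Context: Let $\mathbb{K}$ be any field, $X=\{x_1,\ldots,x_n\}$ a finite set of variables, $W=X^*$ the free monoid of words over $X$, and $F=\mathbb{K}\langle X\rangle$ the free associative algebra, with $\mathbb{K}$-basis $W$. For $w\in W$, $\deg(w)=(\alpha_1,\ldots,\alpha_n)\in\mathbb{N}^n$ where $\alpha_i$ is the number of occurrences of $x_i$ in $w$. For $\bar\delta\in\mathbb{N}^n$, $F[-\bar\delta]$ is the right $F$-module $F$ multigraded by giving a word $w$ the multidegree $\bar\delta+\deg(w)$. The direct sum $\bigoplus_{1\le i\le r}F[-\bar\delta_i]$ is the free right module $F^r$ with canonical basis $e_1,\ldots,e_r$, multigraded by giving $e_iw$ the multidegree $\bar\delta_i+\deg(w)$. A right submodule $M$ of it is multigraded if $M=\sum_{\bar\alpha}M_{\bar\alpha}$ with $M_{\bar\alpha}=M\cap\bigoplus_iF[-\bar\delta_i]_{\bar\alpha}$; the quotient is then multigraded with components $\bigoplus_iF[-\bar\delta_i]_{\bar\alpha}/M_{\bar\alpha}$.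 For a finitely generated multigraded right module $N$, the multigraded Hilbert function is $\mathrm{HF}(N)(\bar\alpha)=\dim_{\mathbb{K}}N_{\bar\alpha}$ ($\bar\alpha\in\mathbb{N}^n$), and the multigraded Hilbert series is $\mathrm{HS}(N)=\sum_{\bar\alpha}\dim_{\mathbb{K}}N_{\bar\alpha}\,t_1^{\alpha_1}\cdots t_n^{\alpha_n}$. The monomials of $F^r$ are the elements of $W(r)=\{e_iw\mid 1\le i\le r,\ w\in W\}$. A monomial ordering of $F^r$ is a well-ordering $\prec$ of $W(r)$ such that $e_iu\prec e_jv$ implies $e_iuw\prec e_jvw$ for all $e_iu,e_jv\in W(r)$ and $w\in W$. For $0\ne f\in F^r$, $\mathrm{lm}(f)$ is the $\prec$-greatest monomial occurring in $f$. For a right submodule $M\subset F^r$, $\mathrm{LM}(M)$ is the right submodule of $F^r$ generated by $\{\mathrm{lm}(f)\mid f\in M, f\ne0\}$. *)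

theory Defs
  imports
    "HOL-Analysis.Finite_Cartesian_Product"
    "HOL-Library.Poly_Mapping"
    "HOL-Algebra.AbelCoset"
    "Jordan_Normal_Form.Missing_VectorSpace"
begin

section \<open>Words and the free associative algebra\<close>

text \<open>The free monoid is written additively, because the monoid algebra of
  \<^theory>\<open>HOL-Library.Poly_Mapping\<close> is over \<^class>\<open>monoid_add\<close>: with the instance below,
  \<open>'x word \<Rightarrow>\<^sub>0 'k\<close> with its library ring structure is the free associative
  algebra over \<open>'k\<close> in the variables \<open>'x\<close>.\<close>

datatype 'x word = Word (letters: "'x list")

instantiation word :: (type) monoid_add
begin

definition zero_word :: "'a word" where
  "0 = Word []"

definition plus_word :: "'a word \<Rightarrow> 'a word \<Rightarrow> 'a word" where
  "u + v = Word (letters u @ letters v)"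

instance
  by standard (simp_all add: zero_word_def plus_word_def)

end

definition word_deg :: "'x word \<Rightarrow> nat ^ 'x::finite" where
  "word_deg w = (\<chi> x. count_list (letters w) x)"

section \<open>The free right module and its right submodules\<close>

type_synonym ('x, 'k, 'r) free_mod = "('x word \<Rightarrow>\<^sub>0 'k) ^ 'r"

definition rmult ::
  "('x, 'k::field, 'r::finite) free_mod \<Rightarrow> ('x word \<Rightarrow>\<^sub>0 'k) \<Rightarrow> ('x, 'k, 'r) free_mod" where
  "rmult f a = (\<chi> i. f $ i * a)"

definition right_submodule :: "('x, 'k::field, 'r::finite) free_mod set \<Rightarrow> bool" where
  "right_submodule M \<longleftrightarrow>
     0 \<in> M \<and> (\<forall>f\<in>M. \<forall>g\<in>M. f + g \<in> M) \<and> (\<forall>f\<in>M. \<forall>a. rmult f a \<in> M)"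

section \<open>Multigrading\<close>

text \<open>The homogeneous component of multidegree \<open>\<alpha>\<close> of the direct sum of the shifted modules
  \<open>F[-\<delta>\<^sub>i]\<close>: the combinations of the monomials \<open>e\<^sub>i w\<close> with \<open>\<delta>\<^sub>i + deg w = \<alpha>\<close>.\<close>

definition hom_component ::
  "(nat ^ 'x) ^ 'r \<Rightarrow> nat ^ 'x \<Rightarrow> ('x::finite, 'k::field, 'r::finite) free_mod set" where
  "hom_component \<delta> \<alpha> =
     {f. \<forall>i w. Poly_Mapping.lookup (f $ i) w \<noteq> 0 \<longrightarrow> \<delta> $ i + word_deg w = \<alpha>}"

definition multigraded ::
  "(nat ^ 'x) ^ 'r \<Rightarrow> ('x::finite, 'k::field, 'r::finite) free_mod set \<Rightarrow> bool" where
  "multigraded \<delta> M \<longleftrightarrow>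
     M = {\<Sum>\<alpha>\<in>A. g \<alpha> | A g. finite A \<and> (\<forall>\<alpha>\<in>A. g \<alpha> \<in> M \<inter> hom_component \<delta> \<alpha>)}"

section \<open>Quotient vector spaces\<close>

definition field_ring :: "'k::field ring" where
  "field_ring = \<lparr>carrier = UNIV, mult = (*), one = 1, zero = 0, add = (+)\<rparr>"

text \<open>In the records below only \<^const>\<open>carrier\<close>, \<^const>\<open>zero\<close>, \<^const>\<open>add\<close> and \<^const>\<open>smult\<close>
  are meaningful; a module record also has fields \<^const>\<open>mult\<close> and \<^const>\<open>one\<close>, which play no role.\<close>

definition vec_space_on ::
  "('x, 'k::field, 'r::finite) free_mod set \<Rightarrow> ('k, ('x, 'k, 'r) free_mod) module" where
  "vec_space_on V =
     \<lparr>carrier = V, mult = (\<lambda>_ _. 0), one = 0, zero = 0, add = (+),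
      smult = (\<lambda>c f. rmult f (Poly_Mapping.single 0 c))\<rparr>"

definition quotient_space :: "('k, 'v) module \<Rightarrow> 'v set \<Rightarrow> ('k, 'v set) module" where
  "quotient_space V U =
     \<lparr>carrier = a_rcosets\<^bsub>V\<^esub> U, mult = (\<lambda>_ _. U), one = U, zero = U, add = set_add V,
      smult = (\<lambda>c S. \<Union>v\<in>S. U +>\<^bsub>V\<^esub> (c \<odot>\<^bsub>V\<^esub> v))\<rparr>"

section \<open>Hilbert function and Hilbert series\<close>

text \<open>Both are those of the quotient of the direct sum of the \<open>F[-\<delta>\<^sub>i]\<close> by \<open>M\<close>. The
  homogeneous components are finite-dimensional, because there are finitely many variables and
  finitely many summands, so \<^const>\<open>vectorspace.dim\<close> never takes its junk value.\<close>

definition hilbert_function ::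
  "(nat ^ 'x) ^ 'r \<Rightarrow> ('x::finite, 'k::field, 'r::finite) free_mod set \<Rightarrow> nat ^ 'x \<Rightarrow> nat" where
  "hilbert_function \<delta> M \<alpha> =
     vectorspace.dim field_ring
       (quotient_space (vec_space_on (hom_component \<delta> \<alpha>)) (M \<inter> hom_component \<delta> \<alpha>))"

text \<open>Formal power series in commuting variables indexed by \<open>'x\<close>, given by their coefficients as
  for the univariate series of \<open>HOL-Computational_Algebra\<close>.\<close>

typedef ('x, 'a) mfps = "UNIV :: (nat ^ 'x \<Rightarrow> 'a) set"
  morphisms mfps_nth Abs_mfps ..

definition hilbert_series ::
  "(nat ^ 'x) ^ 'r \<Rightarrow> ('x::finite, 'k::field, 'r::finite) free_mod set \<Rightarrow> ('x, int) mfps" where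
  "hilbert_series \<delta> M = Abs_mfps (\<lambda>\<alpha>. int (hilbert_function \<delta> M \<alpha>))"

section \<open>Monomial orderings and leading monomials\<close>

text \<open>The pair \<open>(i, w)\<close> stands for the monomial \<open>e\<^sub>i w\<close>. A monomial ordering is given by its
  reflexive version, as usual for \<^const>\<open>well_order_on\<close>; the strict ordering is \<open>R - Id\<close>.\<close>

definition monomial_ordering :: "('r \<times> 'x word) rel \<Rightarrow> bool" where
  "monomial_ordering R \<longleftrightarrow>
     well_order_on UNIV R \<and>
     (\<forall>i u j v w. ((i, u), (j, v)) \<in> R - Id \<longrightarrow> ((i, u + w), (j, v + w)) \<in> R - Id)"

definition mono_vec :: "'r \<times> 'x word \<Rightarrow> ('x, 'k::field, 'r::finite) free_mod" where
  "mono_vec m = axis (fst m) (Poly_Mapping.single (snd m) 1)"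

definition monomials :: "('x, 'k::field, 'r::finite) free_mod \<Rightarrow> ('r \<times> 'x word) set" where
  "monomials f = {(i, w). Poly_Mapping.lookup (f $ i) w \<noteq> 0}"

definition lm :: "('r \<times> 'x word) rel \<Rightarrow> ('x, 'k::field, 'r::finite) free_mod \<Rightarrow> 'r \<times> 'x word"
  where "lm R f = (THE m. m \<in> monomials f \<and> (\<forall>m'\<in>monomials f. (m', m) \<in> R))"

definition LM ::
  "('r \<times> 'x word) rel \<Rightarrow> ('x, 'k::field, 'r::finite) free_mod set \<Rightarrow> ('x, 'k, 'r) free_mod set"
  where "LM R M = right_submodule hull {mono_vec (lm R f) | f. f \<in> M \<and> f \<noteq> 0}"

section \<open>Well-definedness\<close>

text \<open>The components of the quotient are vector spaces over the ground field, and the leading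
  module is a multigraded right submodule, so its Hilbert function is that of a multigraded
  quotient.\<close>

lemma rmult_simps:
  "rmult (f + g) a = rmult f a + rmult g a" "rmult f (a + b) = rmult f a + rmult f b"
  "rmult (rmult f a) b = rmult f (a * b)" "rmult f 1 = f" "rmult 0 a = 0" "rmult f 0 = 0"
  by (auto simp: rmult_def vec_eq_iff algebra_simps)

lemma lookup_mult_single:
  fixes p :: "'x word \<Rightarrow>\<^sub>0 'k::field"
  shows "Poly_Mapping.lookup (p * Poly_Mapping.single v c) w \<noteq> 0 \<Longrightarrow>
    \<exists>u. w = u + v \<and> Poly_Mapping.lookup p u \<noteq> 0"
proof -
  assume "Poly_Mapping.lookup (p * Poly_Mapping.single v c) w \<noteq> 0"
  then have "w \<in> Poly_Mapping.keys (p * Poly_Mapping.single v c)" by (simp add: Poly_Mapping.in_keys_iff)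
  then obtain a b where "w = a + b" "a \<in> Poly_Mapping.keys p" "b \<in> Poly_Mapping.keys (Poly_Mapping.single v c)"
    using Poly_Mapping.keys_mult by blast
  then show ?thesis by (auto simp: Poly_Mapping.in_keys_iff lookup_single when_def split: if_splits)
qed

lemma hom_component_rmult_single:
  assumes "f \<in> hom_component \<delta> \<alpha>"
  shows "rmult f (Poly_Mapping.single v c) \<in> hom_component \<delta> (\<alpha> + word_deg v)"
  using assms lookup_mult_single
  by (fastforce simp: hom_component_def rmult_def word_deg_def vec_eq_iff plus_word_def)

lemma hom_component_add:
  shows "f \<in> hom_component \<delta> \<alpha> \<Longrightarrow> g \<in> hom_component \<delta> \<alpha> \<Longrightarrow> f + g \<in> hom_component \<delta> \<alpha>"
    "0 \<in> hom_component \<delta> \<alpha>"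
  by (auto simp: hom_component_def lookup_add) (metis add.right_neutral)

lemma field_ring: "field (field_ring :: 'k::field ring)"
proof -
  interpret cring "field_ring :: 'k::field ring"
    apply (rule cringI)
    subgoal by (rule abelian_groupI) (auto simp: field_ring_def algebra_simps intro: exI[of _ "- x" for x] left_minus)
    by (auto simp: field_ring_def algebra_simps intro!: comm_monoidI)
  show ?thesis
    by (rule cring_fieldI2) (auto simp: field_ring_def intro: right_inverse)
qed

lemma vec_space_on_hom_component:
  fixes \<delta> :: "(nat ^ 'x::finite) ^ 'r::finite"
  shows "vectorspace field_ring (vec_space_on (hom_component \<delta> \<alpha> :: ('x, 'k::field, 'r) free_mod set))"
proof -
  let ?C = "hom_component \<delta> \<alpha> :: ('x, 'k::field, 'r) free_mod set"
  have c: "rmult f (Poly_Mapping.single 0 c) \<in> ?C" if "f \<in> ?C" for f c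
    using hom_component_rmult_single[OF that, of 0 c] by (simp add: word_deg_def zero_word_def zero_vec_def[symmetric])
  have inv: "\<exists>y\<in>?C. x + y = 0" if "x \<in> ?C" for x
    using that by (intro bexI[of _ "-x"]) (auto simp: hom_component_def)
  have ag: "abelian_group (vec_space_on ?C)"
    by (rule abelian_groupI) (auto simp: vec_space_on_def hom_component_add algebra_simps inv intro: hom_component_add(2))
  have cr: "cring (field_ring :: 'k ring)" using field_ring by (metis domain.axioms(1) field.axioms(1))
  have "module field_ring (vec_space_on ?C)"
    by (rule moduleI) (use cr ag c in \<open>auto simp: vec_space_on_def field_ring_def
        rmult_simps single_add mult_single ac_simps\<close>)
  then show ?thesis using field_ring by (simp add: vectorspace_def)
qed

lemma quotient_space_is_vectorspace:
  assumes "vectorspace K V" "submodule K U V"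
  shows "vectorspace K (quotient_space V U)"
proof -
  interpret vectorspace K V by fact
  interpret U: submodule K U V by fact
  have inv: "\<ominus>\<^bsub>V\<^esub> u \<in> U" if "u \<in> U" for u
  proof -
    have "\<ominus>\<^bsub>K\<^esub> \<one>\<^bsub>K\<^esub> \<odot>\<^bsub>V\<^esub> u \<in> U" by (rule U.smult_closed) (simp_all add: that)
    moreover have "u \<in> carrier V" using that U.subset by blast
    ultimately show ?thesis by (simp add: smult_minus_1)
  qed
  have sub: "additive_subgroup U V"
  proof (intro additive_subgroup.intro M.add.subgroupI)
    show "U \<noteq> {}" using U.zero_closed by blast
  qed (use inv in \<open>auto simp: U.subset a_inv_def\<close>)
  interpret abelian_subgroup U V
    by (rule abelian_subgroupI3) (use sub in \<open>auto intro: abelian_group_axioms M.abelian_group_axioms\<close>)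
  have sm: "(\<Union>v\<in>U +>\<^bsub>V\<^esub> x. U +>\<^bsub>V\<^esub> (c \<odot>\<^bsub>V\<^esub> v)) = U +>\<^bsub>V\<^esub> (c \<odot>\<^bsub>V\<^esub> x)"
    if "c \<in> carrier K" "x \<in> carrier V" for c x
  proof -
    have "U +>\<^bsub>V\<^esub> (c \<odot>\<^bsub>V\<^esub> v) = U +>\<^bsub>V\<^esub> (c \<odot>\<^bsub>V\<^esub> x)" if v: "v \<in> U +>\<^bsub>V\<^esub> x" for v
    proof -
      obtain u where u: "u \<in> U" "v = u \<oplus>\<^bsub>V\<^esub> x" using v unfolding a_r_coset_def' by blast
      have "c \<odot>\<^bsub>V\<^esub> v \<in> U +>\<^bsub>V\<^esub> (c \<odot>\<^bsub>V\<^esub> x)"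
      proof -
        have "u \<in> carrier V" using u U.subset by blast
        then have "c \<odot>\<^bsub>V\<^esub> v = c \<odot>\<^bsub>V\<^esub> u \<oplus>\<^bsub>V\<^esub> c \<odot>\<^bsub>V\<^esub> x"
          using u \<open>c \<in> _\<close> \<open>x \<in> _\<close> by (simp add: smult_r_distr)
        moreover have "c \<odot>\<^bsub>V\<^esub> u \<in> U" using u \<open>c \<in> _\<close> by simp
        ultimately show ?thesis unfolding a_r_coset_def' by blast
      qed
      then show ?thesis using \<open>c \<in> _\<close> \<open>x \<in> _\<close> by (metis a_repr_independence smult_closed a_subgroup sub)
    qed
    then show ?thesis using a_rcos_self[OF \<open>x \<in> _\<close>] by blast
  qed
  have car: "x \<in> carrier (quotient_space V U) \<longleftrightarrow> (\<exists>v\<in>carrier V. x = U +>\<^bsub>V\<^esub> v)" for x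
    by (auto simp: quotient_space_def A_RCOSETS_def')
  have sm': "c \<odot>\<^bsub>quotient_space V U\<^esub> (U +>\<^bsub>V\<^esub> x) = U +>\<^bsub>V\<^esub> (c \<odot>\<^bsub>V\<^esub> x)"
    if "c \<in> carrier K" "x \<in> carrier V" for c x using sm[OF that] by (simp add: quotient_space_def)
  have ad: "(U +>\<^bsub>V\<^esub> x) \<oplus>\<^bsub>quotient_space V U\<^esub> (U +>\<^bsub>V\<^esub> y) = U +>\<^bsub>V\<^esub> (x \<oplus>\<^bsub>V\<^esub> y)"
    if "x \<in> carrier V" "y \<in> carrier V" for x y using that by (simp add: quotient_space_def a_rcos_sum)
  have zr: "\<zero>\<^bsub>quotient_space V U\<^esub> = U +>\<^bsub>V\<^esub> \<zero>\<^bsub>V\<^esub>"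
    using a_coset_add_zero[OF a_subset] by (simp add: quotient_space_def)
  have ag: "abelian_group (quotient_space V U)"
  proof (rule abelian_groupI)
    fix x assume "x \<in> carrier (quotient_space V U)"
    then obtain v where v: "v \<in> carrier V" "x = U +>\<^bsub>V\<^esub> v" using car by blast
    then have "U +>\<^bsub>V\<^esub> (\<ominus>\<^bsub>V\<^esub> v) \<in> carrier (quotient_space V U)" using car by blast
    moreover have "(U +>\<^bsub>V\<^esub> (\<ominus>\<^bsub>V\<^esub> v)) \<oplus>\<^bsub>quotient_space V U\<^esub> x = \<zero>\<^bsub>quotient_space V U\<^esub>"
      using v by (simp add: ad zr M.l_neg)
    ultimately show "\<exists>y\<in>carrier (quotient_space V U).
        y \<oplus>\<^bsub>quotient_space V U\<^esub> x = \<zero>\<^bsub>quotient_space V U\<^esub>" by blast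
  next
    show "\<zero>\<^bsub>quotient_space V U\<^esub> \<in> carrier (quotient_space V U)"
      using car zr by blast
  qed (clarsimp simp: car ad zr M.a_ac; blast)+
  have "module K (quotient_space V U)"
    by (rule moduleI) (use ag R.is_cring in \<open>auto simp: car sm' ad smult_l_distr smult_r_distr smult_assoc1\<close>)
  then show ?thesis using field_axioms by (simp add: vectorspace_def)
qed

lemma submodule_component:
  fixes \<delta> :: "(nat ^ 'x::finite) ^ 'r::finite" and M :: "('x, 'k::field, 'r) free_mod set"
  assumes "right_submodule M"
  shows "submodule field_ring (M \<inter> hom_component \<delta> \<alpha>) (vec_space_on (hom_component \<delta> \<alpha>))"
proof -
  interpret vectorspace field_ring "vec_space_on (hom_component \<delta> \<alpha> :: ('x, 'k::field, 'r) free_mod set)"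
    by (rule vec_space_on_hom_component)
  show ?thesis
    using assms hom_component_add module_axioms smult_closed
    by (auto simp: submodule_def vec_space_on_def right_submodule_def field_ring_def)
qed

corollary hilbert_space_is_vectorspace:
  fixes \<delta> :: "(nat ^ 'x::finite) ^ 'r::finite" and M :: "('x, 'k::field, 'r) free_mod set"
  assumes "right_submodule M"
  shows "vectorspace field_ring
    (quotient_space (vec_space_on (hom_component \<delta> \<alpha>)) (M \<inter> hom_component \<delta> \<alpha>))"
  by (rule quotient_space_is_vectorspace[OF vec_space_on_hom_component submodule_component[OF assms]])

lemma right_submodule_LM: "right_submodule (LM R M)"
  unfolding LM_def by (rule hull_in) (auto simp: right_submodule_def)

lemma LM_multigraded:
  fixes \<delta> :: "(nat ^ 'x::finite) ^ 'r::finite" and M :: "('x, 'k::field, 'r) free_mod set"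
  shows "multigraded \<delta> (LM R M)"
proof -
  let ?L = "LM R M" and ?C = "hom_component \<delta> :: _ \<Rightarrow> ('x, 'k, 'r) free_mod set"
  let ?S = "{\<Sum>\<alpha>\<in>A. g \<alpha> | A g. finite A \<and> (\<forall>\<alpha>\<in>A. g \<alpha> \<in> ?L \<inter> ?C \<alpha>)}"
  note L = right_submodule_LM[of R M, unfolded right_submodule_def]
  have sumL: "(\<Sum>a\<in>A. g a) \<in> ?L" if "finite A" "\<And>a. a \<in> A \<Longrightarrow> g a \<in> ?L" for A and g :: "'z \<Rightarrow> _"
    using that by (induction A rule: finite_induct) (use L in auto)
  have "?S \<subseteq> ?L" using sumL by blast
  have zero: "0 \<in> ?S" by (auto intro!: exI[of _ "{}"])
  have hom: "f \<in> ?S" if "f \<in> ?L" "f \<in> ?C \<alpha>" for f \<alpha>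
    using that by (auto intro!: exI[of _ "{\<alpha>}"] exI[of _ "\<lambda>_. f"])
  have add: "f + g \<in> ?S" if fg: "f \<in> ?S" "g \<in> ?S" for f g
  proof -
    from fg(1) obtain A p where p: "f = sum p A" "finite A" "\<forall>\<alpha>\<in>A. p \<alpha> \<in> ?L \<inter> ?C \<alpha>" by blast
    from fg(2) obtain B q where q: "g = sum q B" "finite B" "\<forall>\<alpha>\<in>B. q \<alpha> \<in> ?L \<inter> ?C \<alpha>" by blast
    let ?p = "\<lambda>\<alpha>. if \<alpha> \<in> A then p \<alpha> else 0" and ?q = "\<lambda>\<alpha>. if \<alpha> \<in> B then q \<alpha> else 0"
    have "f = sum ?p (A \<union> B)" "g = sum ?q (A \<union> B)"
      using p q by (auto intro!: sum.mono_neutral_cong_left)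
    then have "f + g = (\<Sum>\<alpha>\<in>A \<union> B. ?p \<alpha> + ?q \<alpha>)" by (simp only: sum.distrib)
    moreover have "\<forall>\<alpha>\<in>A\<union>B. ?p \<alpha> + ?q \<alpha> \<in> ?L \<inter> ?C \<alpha>"
      using p(3) q(3) L by (auto intro!: hom_component_add)
    ultimately show ?thesis using \<open>finite A\<close> \<open>finite B\<close> by blast
  qed
  have sumS: "(\<Sum>a\<in>A. g a) \<in> ?S" if "finite A" "\<And>a. a \<in> A \<Longrightarrow> g a \<in> ?S" for A and g :: "'z \<Rightarrow> _"
    using that by (induction A rule: finite_induct) (use zero add in auto)
  have single: "rmult f (Poly_Mapping.single v c) \<in> ?S" if f: "f \<in> ?S" for f v c
  proof -
    from f obtain A p where p: "f = sum p A" "finite A" "\<forall>\<alpha>\<in>A. p \<alpha> \<in> ?L \<inter> ?C \<alpha>" by blast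
    have "rmult f (Poly_Mapping.single v c) = (\<Sum>\<alpha>\<in>A. rmult (p \<alpha>) (Poly_Mapping.single v c))"
      unfolding p(1) using p(2) by (induction A rule: finite_induct) (auto simp: rmult_simps)
    also have "\<dots> \<in> ?S"
    proof (rule sumS)
      fix \<alpha> assume "\<alpha> \<in> A"
      then have "p \<alpha> \<in> ?L" "p \<alpha> \<in> ?C \<alpha>" using p by auto
      then show "rmult (p \<alpha>) (Poly_Mapping.single v c) \<in> ?S"
        using L hom_component_rmult_single by (intro hom) blast+
    qed (fact p)
    finally show ?thesis .
  qed
  have mult: "rmult f a \<in> ?S" if f: "f \<in> ?S" for f a
  proof (induction a rule: update_induct)
    case const
    show ?case using zero by (simp add: rmult_simps)
  next
    case (update a b c)
    have "Poly_Mapping.update b c a = a + Poly_Mapping.single b c"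
      using update(1) by (intro poly_mapping_eqI) (auto simp: lookup_update lookup_add lookup_single when_def Poly_Mapping.in_keys_iff)
    then show ?case using add[OF update(3) single[OF f]] by (simp add: rmult_simps)
  qed
  have sub: "right_submodule ?S"
    unfolding right_submodule_def by (intro conjI ballI allI zero add mult)
  have gen: "mono_vec (lm R f) \<in> ?S" if "f \<in> M" "f \<noteq> 0" for f
  proof (rule hom)
    show "mono_vec (lm R f) \<in> ?L" unfolding LM_def using that by (intro hull_inc) blast
    show "mono_vec (lm R f) \<in> ?C (\<delta> $ fst (lm R f) + word_deg (snd (lm R f)))"
      by (auto simp: hom_component_def mono_vec_def axis_def lookup_single when_def split: if_splits)
  qed
  have "{mono_vec (lm R f) | f. f \<in> M \<and> f \<noteq> 0} \<subseteq> ?S"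
  proof
    fix h :: "('x, 'k, 'r) free_mod"
    assume "h \<in> {mono_vec (lm R f) | f. f \<in> M \<and> f \<noteq> 0}"
    then obtain f where f: "f \<in> M" "f \<noteq> 0" and h: "h = mono_vec (lm R f)" by blast
    show "h \<in> ?S" unfolding h by (rule gen[OF f])
  qed
  from hull_minimal[of _ _ right_submodule, OF this sub] have "?L \<subseteq> ?S" by (simp only: LM_def)
  with \<open>?S \<subseteq> ?L\<close> have "?L = ?S" by (rule subset_antisym[rotated])
  then show ?thesis by (simp only: multigraded_def)
qed

end

theory Submission
  imports Defs
begin

text \<open>Reduction with respect to a well-founded monomial ordering shows that a subspace \<open>U\<close> of the
  component of multidegree \<open>\<alpha>\<close> has as complement the span of the monomials of that multidegree
  that are not leading monomials of elements of \<open>U\<close>. Since \<open>M\<close> is multigraded, the components of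
  \<open>M\<close> and of \<open>LM(M)\<close> have the same leading monomials, so the two quotients are isomorphic to the
  same space of normal forms.\<close>

section \<open>Linear subspaces, supports and coefficients\<close>

text \<open>The scalar action of \<open>vec_space_on\<close>, detached from any particular
  carrier.\<close>

definition scale :: "'k \<Rightarrow> ('x, 'k::field, 'r::finite) free_mod \<Rightarrow> ('x, 'k, 'r) free_mod" where
  "scale c f = rmult f (Poly_Mapping.single 0 c)"

definition lin_subspace :: "('x, 'k::field, 'r::finite) free_mod set \<Rightarrow> bool" where
  "lin_subspace U \<longleftrightarrow> 0 \<in> U \<and> (\<forall>f\<in>U. \<forall>g\<in>U. f + g \<in> U) \<and> (\<forall>f\<in>U. \<forall>c. scale c f \<in> U)"

text \<open>The span over the ground field of the monomials in \<open>D\<close>. Every vector has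
  finite support, so this is true for infinite \<open>D\<close> as well.\<close>

definition supported :: "('r \<times> 'x word) set \<Rightarrow> ('x, 'k::field, 'r::finite) free_mod set" where
  "supported D = {f. monomials f \<subseteq> D}"

definition degree_monomials ::
  "(nat ^ 'x) ^ 'r \<Rightarrow> nat ^ 'x \<Rightarrow> ('r::finite \<times> 'x::finite word) set" where
  "degree_monomials \<delta> \<alpha> = {(i, w). \<delta> $ i + word_deg w = \<alpha>}"

text \<open>Zero is removed because it has no monomials, so that \<open>lm R 0\<close> is an
  unspecified value.\<close>

definition leading ::
  "('r \<times> 'x word) rel \<Rightarrow> ('x, 'k::field, 'r::finite) free_mod set \<Rightarrow> ('r \<times> 'x word) set" where
  "leading R U = lm R ` (U - {0})"

definition coeff_at :: "('x, 'k::field, 'r::finite) free_mod \<Rightarrow> 'r \<times> 'x word \<Rightarrow> 'k" where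
  "coeff_at f m = Poly_Mapping.lookup (f $ fst m) (snd m)"

lemma in_monomials_iff: "m \<in> monomials f \<longleftrightarrow> coeff_at f m \<noteq> 0"
  by (auto simp: monomials_def coeff_at_def)

lemma in_leading_iff: "m \<in> leading R U \<longleftrightarrow> (\<exists>f\<in>U. f \<noteq> 0 \<and> lm R f = m)"
  by (auto simp: leading_def)

lemma free_mod_eqI: "(\<And>m. coeff_at f m = coeff_at g m) \<Longrightarrow> f = g"
  by (auto simp: coeff_at_def vec_eq_iff intro!: poly_mapping_eqI)

text \<open>The free monoid is right cancellative, so right multiplication by a word keeps distinct
  words distinct and no coefficients merge.\<close>

lemma lookup_mult_single_add:
  fixes p :: "'x word \<Rightarrow>\<^sub>0 'k::field"
  shows "Poly_Mapping.lookup (p * Poly_Mapping.single v c) (u + v) = Poly_Mapping.lookup p u * c"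
proof (induction p rule: update_induct)
  case const
  show ?case by simp
next
  case (update p b d)
  have cancel: "b + v = u + v \<longleftrightarrow> b = u" by (cases b; cases u) (auto simp: plus_word_def)
  have "Poly_Mapping.update b d p = p + Poly_Mapping.single b d"
    using update(1) by (intro poly_mapping_eqI)
      (auto simp: lookup_update lookup_add lookup_single when_def Poly_Mapping.in_keys_iff)
  then show ?case
    using update(3) by (simp add: distrib_right mult_single lookup_add lookup_single cancel when_def)
qed

lemma coeff_at_simps [simp]:
  "coeff_at 0 m = 0" "coeff_at (f + g) m = coeff_at f m + coeff_at g m"
  "coeff_at (f - g) m = coeff_at f m - coeff_at g m"
  "coeff_at (scale c f) m = coeff_at f m * c"
  "coeff_at (sum h A) m = (\<Sum>a\<in>A. coeff_at (h a) m)"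
  "coeff_at (mono_vec m') m = (if m = m' then 1 else 0)"
  \<comment> \<open>Scaling is the shift by the empty word, which is \<open>0\<close> in the
    additive notation.\<close>
  using lookup_mult_single_add[of "f $ fst m" 0 c "snd m"]
  by (auto simp: coeff_at_def scale_def rmult_def lookup_add lookup_minus lookup_sum
      mono_vec_def axis_def lookup_single when_def prod_eq_iff)

lemma monomials_empty_iff: "monomials f = {} \<longleftrightarrow> f = 0"
  by (metis coeff_at_simps(1) empty_iff equals0I free_mod_eqI in_monomials_iff)

lemma monomials_mono_vec [simp]: "monomials (mono_vec m :: ('x, 'k::field, 'r::finite) free_mod) = {m}"
  by (auto simp del: split_paired_All simp: set_eq_iff in_monomials_iff)

lemma mono_vec_nonzero: "mono_vec m \<noteq> (0 :: ('x, 'k::field, 'r::finite) free_mod)"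
  using monomials_mono_vec monomials_empty_iff by (metis insert_not_empty)

lemma scale_minus_one: "scale (- 1) f = - f"
  by (rule free_mod_eqI) (simp add: coeff_at_def[of "- f"] lookup_uminus, simp add: coeff_at_def)

lemma lin_subspace_diff: "lin_subspace U \<Longrightarrow> f \<in> U \<Longrightarrow> g \<in> U \<Longrightarrow> f - g \<in> U"
  unfolding lin_subspace_def using scale_minus_one[of g] by (metis uminus_add_conv_diff add.commute)

lemma lin_subspace_supported: "lin_subspace (supported D)"
  unfolding lin_subspace_def supported_def subset_eq Ball_def mem_Collect_eq in_monomials_iff
    coeff_at_simps by (metis add_0 mult_zero_left)

lemma right_submodule_imp_lin_subspace: "right_submodule M \<Longrightarrow> lin_subspace M"
  by (auto simp: right_submodule_def lin_subspace_def scale_def)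

lemma lin_subspace_Int: "lin_subspace U \<Longrightarrow> lin_subspace V \<Longrightarrow> lin_subspace (U \<inter> V)"
  by (auto simp: lin_subspace_def)

section \<open>Homogeneous components as finite-dimensional spaces\<close>

lemma hom_component_eq_supported: "hom_component \<delta> \<alpha> = supported (degree_monomials \<delta> \<alpha>)"
  by (auto simp: hom_component_def supported_def degree_monomials_def monomials_def)

lemma finite_monomials: "finite (monomials f)"
proof -
  have "monomials f = (SIGMA i:UNIV. Poly_Mapping.keys (f $ i))"
    by (auto simp: monomials_def Poly_Mapping.in_keys_iff)
  then show ?thesis by simp
qed

text \<open>The entries of a word's degree add up to its length, so the words that occur are no
  longer than the total degree of \<alpha>; over a finite alphabet there are finitely many of
  them.\<close>

lemma finite_degree_monomials:
  fixes \<delta> :: "(nat ^ 'x::finite) ^ 'r::finite"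
  shows "finite (degree_monomials \<delta> \<alpha>)"
proof -
  have len: "length (letters w) = (\<Sum>x\<in>UNIV. word_deg w $ x)" for w :: "'x word"
    by (simp add: word_deg_def sum_count_set)
  \<comment> \<open>The length is bounded rather than determined because \<open>\<delta> $ i\<close>
    takes up part of \<alpha>; the bound is uniform in \<open>i\<close>.\<close>
  have "w \<in> Word ` {xs. set xs \<subseteq> UNIV \<and> length xs \<le> (\<Sum>x\<in>UNIV. \<alpha> $ x)}"
    if "\<delta> $ i + word_deg w = \<alpha>" for i w
    using that len[of w] by (intro image_eqI[of _ _ "letters w"]) (auto intro!: sum_mono)
  then have "degree_monomials \<delta> \<alpha> \<subseteq>
      UNIV \<times> Word ` {xs. set xs \<subseteq> UNIV \<and> length xs \<le> (\<Sum>x\<in>UNIV. \<alpha> $ x)}"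
    by (auto simp: degree_monomials_def)
  then show ?thesis
    by (rule finite_subset) (intro finite_cartesian_product finite_imageI finite_lists_length_le; simp)
qed

lemma lin_subspace_imp_submodule:
  fixes \<delta> :: "(nat ^ 'x::finite) ^ 'r::finite" and U :: "('x, 'k::field, 'r) free_mod set"
  assumes "lin_subspace U" "U \<subseteq> hom_component \<delta> \<alpha>"
  shows "submodule field_ring U (vec_space_on (hom_component \<delta> \<alpha>))"
proof -
  interpret vectorspace field_ring "vec_space_on (hom_component \<delta> \<alpha> :: ('x, 'k, 'r) free_mod set)"
    by (rule vec_space_on_hom_component)
  show ?thesis
    using assms module_axioms
    by (auto simp: submodule_def vec_space_on_def lin_subspace_def field_ring_def scale_def)
qed

lemma vectorspace_lin_subspace:
  fixes \<delta> :: "(nat ^ 'x::finite) ^ 'r::finite" and U :: "('x, 'k::field, 'r) free_mod set"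
  assumes "lin_subspace U" "U \<subseteq> hom_component \<delta> \<alpha>"
  shows "vectorspace field_ring (vec_space_on U)"
proof -
  interpret vectorspace field_ring "vec_space_on (hom_component \<delta> \<alpha> :: ('x, 'k, 'r) free_mod set)"
    by (rule vec_space_on_hom_component)
  show ?thesis
    using submodule_is_module[OF lin_subspace_imp_submodule[OF assms]] field_ring
    by (simp add: vectorspace_def vec_space_on_def)
qed

text \<open>The monomials in \<open>D\<close> span, and there are finitely many of them. This
  supplies the finiteness that is required when dimensions are compared along a linear
  isomorphism.\<close>

lemma fin_dim_supported:
  fixes \<delta> :: "(nat ^ 'x::finite) ^ 'r::finite"
  assumes D: "D \<subseteq> degree_monomials \<delta> \<alpha>"
  shows "vectorspace.fin_dim field_ring
    (vec_space_on (supported D :: ('x, 'k::field, 'r) free_mod set))"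
proof -
  let ?V = "supported D :: ('x, 'k, 'r) free_mod set"
  interpret vectorspace field_ring "vec_space_on ?V"
    using D by (intro vectorspace_lin_subspace lin_subspace_supported)
      (auto simp: hom_component_eq_supported supported_def)
  have B: "mono_vec ` D \<subseteq> carrier (vec_space_on ?V)"
    by (auto simp: vec_space_on_def supported_def)
  interpret S: submodule field_ring "span (mono_vec ` D)" "vec_space_on ?V"
    by (rule span_is_submodule[OF B])
  have add: "f + g \<in> span (mono_vec ` D)" if "f \<in> span (mono_vec ` D)" "g \<in> span (mono_vec ` D)" for f g
    using S.m_closed[OF that] by (simp add: vec_space_on_def)
  have sc: "scale c f \<in> span (mono_vec ` D)" if "f \<in> span (mono_vec ` D)" for c f
    using S.smult_closed[of c f] that by (simp add: vec_space_on_def field_ring_def scale_def)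
  have "f \<in> span (mono_vec ` D)" if "f \<in> ?V" for f
    using that
  proof (induction "card (monomials f)" arbitrary: f rule: less_induct)
    case less
    show ?case
    proof (cases "f = 0")
      case True
      then show ?thesis using S.zero_closed by (simp add: vec_space_on_def)
    next
      case False
      then obtain m where m: "m \<in> monomials f" using monomials_empty_iff by blast
      \<comment> \<open>The term of \<open>f\<close> at \<open>m\<close>. Subtracting it deletes
        exactly \<open>m\<close> from the support, which decreases the induction measure.\<close>
      define t :: "('x, 'k, 'r) free_mod" where "t = scale (coeff_at f m) (mono_vec m)"
      have mons: "monomials (f - t) = monomials f - {m}"
        by (auto simp: t_def in_monomials_iff split: if_splits)
      have "t \<in> span (mono_vec ` D)"
        unfolding t_def using m less.prems in_own_span[OF B] by (intro sc) (auto simp: supported_def)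
      moreover have "f - t \<in> span (mono_vec ` D)"
      proof (rule less.hyps)
        show "card (monomials (f - t)) < card (monomials f)"
          using m by (simp add: mons finite_monomials card_Diff1_less del: card_Diff_insert)
        show "f - t \<in> ?V" using less.prems by (auto simp: supported_def mons)
      qed
      ultimately show ?thesis using add[of t "f - t"] by simp
    qed
  qed
  then have "span (mono_vec ` D) = carrier (vec_space_on ?V)"
    using span_is_subset2[OF B] by (auto simp: vec_space_on_def)
  moreover have "finite D" using D finite_degree_monomials by (rule finite_subset)
  ultimately show ?thesis using B unfolding fin_dim_def by blast
qed

section \<open>Quotients and complements\<close>

text \<open>The coset map restricted to \<open>V\<close> is a linear isomorphism onto the quotient:
  trivial intersection with \<open>U\<close> makes it injective, and the decomposition of
  \<open>C\<close> makes it surjective.\<close>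

lemma dim_quotient_eq_dim_complement:
  fixes \<delta> :: "(nat ^ 'x::finite) ^ 'r::finite" and \<alpha> :: "nat ^ 'x"
    and U V :: "('x, 'k::field, 'r) free_mod set"
  defines "C \<equiv> hom_component \<delta> \<alpha>"
  assumes U: "lin_subspace U" "U \<subseteq> C" and V: "lin_subspace V" "V \<subseteq> C"
    and fin: "vectorspace.fin_dim field_ring (vec_space_on V)"
    and disj: "U \<inter> V = {0}" and sum: "\<And>f. f \<in> C \<Longrightarrow> \<exists>u\<in>U. \<exists>v\<in>V. f = u + v"
  shows "vectorspace.dim field_ring (quotient_space (vec_space_on C) U) =
    vectorspace.dim field_ring (vec_space_on V)"
proof -
  let ?Q = "quotient_space (vec_space_on C) U"
  \<comment> \<open>The coset of \<open>f\<close> modulo \<open>U\<close> as a plain set of vectors,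
    so that coset identities reduce to membership of differences in \<open>U\<close>.\<close>
  define T where "T f = (\<lambda>u. u + f) ` U" for f
  have coset: "U +>\<^bsub>vec_space_on C\<^esub> f = T f" for f
    by (auto simp: a_r_coset_def' vec_space_on_def T_def)
  have in_T: "g \<in> T f \<longleftrightarrow> g - f \<in> U" for f g
    by (auto simp: T_def image_iff intro!: bexI[of _ "g - f"])
  have T_eq: "T f = T g" if "f - g \<in> U" for f g
  proof -
    have "h - f \<in> U \<longleftrightarrow> h - g \<in> U" for h
    proof
      assume "h - f \<in> U"
      then have "(h - f) + (f - g) \<in> U" using that U(1) unfolding lin_subspace_def by blast
      then show "h - g \<in> U" by simp
    next
      assume "h - g \<in> U"
      then have "(h - g) - (f - g) \<in> U" using that by (rule lin_subspace_diff[OF U(1)])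
      then show "h - f \<in> U" by simp
    qed
    then show ?thesis by (auto simp: in_T)
  qed
  have add: "set_add (vec_space_on C) (T f) (T g) = T (f + g)" for f g
  proof -
    \<comment> \<open>The whole difference goes to the first summand, and the second one receives
      \<open>0\<close>.\<close>
    have split: "\<exists>u\<in>U. \<exists>v\<in>U. h = (u + f) + (v + g)" if "h - (f + g) \<in> U" for h
      using that U(1) by (intro bexI[of _ "h - (f + g)"] bexI[of _ 0]) (auto simp: lin_subspace_def)
    have join: "(u + f) + (v + g) - (f + g) \<in> U" if "u \<in> U" "v \<in> U" for u v
      using that U(1) by (simp add: lin_subspace_def algebra_simps)
    have "set_add (vec_space_on C) (T f) (T g) = {(u + f) + (v + g) | u v. u \<in> U \<and> v \<in> U}"
      by (auto simp: set_add_def' vec_space_on_def T_def)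
    also have "\<dots> = T (f + g)"
    proof (intro Set.set_eqI iffI)
      fix h assume "h \<in> {(u + f) + (v + g) | u v. u \<in> U \<and> v \<in> U}"
      then obtain u v where "u \<in> U" "v \<in> U" and h: "h = (u + f) + (v + g)" by blast
      then have "h - (f + g) \<in> U" using join by blast
      then show "h \<in> T (f + g)" by (simp only: in_T)
    next
      fix h assume "h \<in> T (f + g)"
      then have "h - (f + g) \<in> U" by (simp only: in_T)
      then show "h \<in> {(u + f) + (v + g) | u v. u \<in> U \<and> v \<in> U}" using split by blast
    qed
    finally show ?thesis .
  qed
  \<comment> \<open>In \<open>quotient_space\<close>, scaling takes the union over all
    representatives. They all yield the same coset, and \<open>f\<close> itself is a representative,
    so the union is that coset and not empty.\<close>
  have smult: "(\<Union>v\<in>T f. T (scale c v)) = T (scale c f)" for c f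
  proof -
    have "T (scale c v) = T (scale c f)" if "v \<in> T f" for v
    proof (rule T_eq)
      have "scale c v - scale c f = scale c (v - f)" by (rule free_mod_eqI) (simp add: algebra_simps)
      then show "scale c v - scale c f \<in> U" using that U(1) by (simp add: in_T lin_subspace_def)
    qed
    moreover have "f \<in> T f" using U(1) by (simp add: in_T lin_subspace_def)
    ultimately show ?thesis by blast
  qed
  have carrier_Q: "carrier ?Q = T ` C"
    by (auto simp: quotient_space_def A_RCOSETS_def' coset) (auto simp: vec_space_on_def)
  \<comment> \<open>Since \<open>f\<close> lies in its own coset, equality of cosets puts
    \<open>f - g\<close> into both \<open>U\<close> and \<open>V\<close>.\<close>
  have "T f = T g \<Longrightarrow> f = g" if "f \<in> V" "g \<in> V" for f g
  proof -
    assume "T f = T g"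
    then have "f - g \<in> U" using in_T U(1) by (metis diff_self lin_subspace_def)
    moreover have "f - g \<in> V" using that V(1) by (rule lin_subspace_diff[rotated])
    ultimately have "f - g = 0" using disj by blast
    then show "f = g" by simp
  qed
  then have inj: "inj_on T V" by (auto intro: inj_onI)
  have surj: "T ` V = T ` C"
  proof
    show "T ` C \<subseteq> T ` V"
    proof clarify
      fix f assume "f \<in> C"
      then obtain u v where "u \<in> U" "v \<in> V" "f = u + v" using sum by blast
      then show "T f \<in> T ` V" using T_eq[of f v] by auto
    qed
  qed (use V(2) in blast)
  have vsV: "vectorspace field_ring (vec_space_on V)"
    using V unfolding C_def by (rule vectorspace_lin_subspace)
  have vsQ: "vectorspace field_ring ?Q"
    using U unfolding C_def
    by (intro quotient_space_is_vectorspace vec_space_on_hom_component lin_subspace_imp_submodule)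
  have add_Q: "T f \<oplus>\<^bsub>?Q\<^esub> T g = T (f + g)" for f g
    by (simp add: quotient_space_def add)
  have smult_W: "c \<odot>\<^bsub>vec_space_on W\<^esub> f = scale c f" for c f and W :: "('x, 'k, 'r) free_mod set"
    by (simp add: vec_space_on_def scale_def)
  have smult_Q: "c \<odot>\<^bsub>?Q\<^esub> T f = T (scale c f)" for c f
    by (simp add: quotient_space_def coset smult_W smult)
  have add_V: "f \<oplus>\<^bsub>vec_space_on V\<^esub> g = f + g" for f g
    by (simp add: vec_space_on_def)
  have carrier_V: "carrier (vec_space_on V) = V"
    by (simp add: vec_space_on_def)
  have "T \<in> module_hom field_ring (vec_space_on V) ?Q"
    using surj by (auto simp: module_hom_def carrier_Q add_Q smult_Q add_V smult_W carrier_V)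
  then have "linear_map field_ring (vec_space_on V) ?Q T"
    using vsV vsQ by (simp add: linear_map_def mod_hom_def mod_hom_axioms_def vectorspace_def)
  from linear_map.dim_eq[OF this fin] show ?thesis
    using inj surj by (simp add: carrier_Q carrier_V)
qed

section \<open>Leading monomials under a fixed monomial ordering\<close>

context
  fixes R :: "('r::finite \<times> 'x::finite word) rel"
  assumes R: "monomial_ordering R"
begin

lemma monomial_ordering_props:
  shows "refl R" "trans R" "antisym R" "total R" "wf (R - Id)"
  using R by (auto simp: monomial_ordering_def well_order_on_def linear_order_on_def
      partial_order_on_def preorder_on_def)

lemma lm_eqI: "m \<in> monomials f \<Longrightarrow> (\<And>m'. m' \<in> monomials f \<Longrightarrow> (m', m) \<in> R) \<Longrightarrow> lm R f = m"
  unfolding lm_def using monomial_ordering_props(3) by (intro the_equality) (auto dest: antisymD)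

text \<open>A nonempty finite set has a greatest element in a total order, so the description
  defining \<open>lm\<close> denotes for every nonzero vector.\<close>

lemma lm_props:
  assumes "f \<noteq> 0"
  shows "lm R f \<in> monomials f" "m \<in> monomials f \<Longrightarrow> (m, lm R f) \<in> R"
proof -
  have "\<exists>m\<in>A. \<forall>m'\<in>A. (m', m) \<in> R" if "finite A" "A \<noteq> {}" for A
    using that
  proof (induction A rule: finite_ne_induct)
    case (singleton x)
    then show ?case using monomial_ordering_props(1) by (auto dest: reflD)
  next
    case (insert x A)
    then obtain m where m: "m \<in> A" "\<forall>m'\<in>A. (m', m) \<in> R" by blast
    show ?case
    proof (cases "(x, m) \<in> R")
      case True
      then show ?thesis using m by blast
    next
      case False
      then have "(m, x) \<in> R" "(x, x) \<in> R"
        using monomial_ordering_props(1,4) by (metis UNIV_I reflD total_on_def)+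
      then have "\<forall>m'\<in>insert x A. (m', x) \<in> R" using m(2) monomial_ordering_props(2) by (auto dest: transD)
      then show ?thesis by blast
    qed
  qed
  from this[of "monomials f"] obtain m0
    where m0: "m0 \<in> monomials f" "\<forall>m'\<in>monomials f. (m', m0) \<in> R"
    by (auto simp: finite_monomials monomials_empty_iff assms)
  have "lm R f = m0" by (rule lm_eqI) (use m0 in blast)+
  then show "lm R f \<in> monomials f" "m \<in> monomials f \<Longrightarrow> (m, lm R f) \<in> R" using m0 by auto
qed

lemma lm_mono_vec: "lm R (mono_vec m :: ('x, 'k::field, 'r) free_mod) = m"
  using monomial_ordering_props(1) by (intro lm_eqI) (auto simp: in_monomials_iff dest: reflD split: if_splits)

text \<open>Right multiplication by a word shifts the support bijectively, and compatibility of the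
  ordering preserves the comparisons, so the greatest monomial is shifted to the greatest
  monomial.\<close>

lemma leading_rmult_single:
  assumes f: "f \<noteq> 0"
  shows "rmult f (Poly_Mapping.single v 1) \<noteq> 0"
    "lm R (rmult f (Poly_Mapping.single v 1)) = (fst (lm R f), snd (lm R f) + v)"
proof -
  let ?g = "rmult f (Poly_Mapping.single v 1)"
  have shift: "(i, u + v) \<in> monomials ?g \<longleftrightarrow> (i, u) \<in> monomials f" for i u
    by (simp add: monomials_def rmult_def lookup_mult_single_add)
  have lead: "(fst (lm R f), snd (lm R f) + v) \<in> monomials ?g"
    using lm_props(1)[OF f] by (simp add: shift)
  then show "?g \<noteq> 0" using monomials_empty_iff by blast
  show "lm R ?g = (fst (lm R f), snd (lm R f) + v)"
  proof (rule lm_eqI[OF lead])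
    fix m assume m: "m \<in> monomials ?g"
    obtain i w where [simp]: "m = (i, w)" by (cases m)
    obtain u where u: "w = u + v"
      using m lookup_mult_single[of "f $ i" v 1 w] by (auto simp: monomials_def rmult_def)
    then have "(i, u) \<in> monomials f" using m shift by simp
    then have le: "((i, u), lm R f) \<in> R" by (rule lm_props(2)[OF f])
    \<comment> \<open>Compatibility speaks of strict comparisons only; the case of equality follows
      from reflexivity.\<close>
    show "(m, (fst (lm R f), snd (lm R f) + v)) \<in> R"
    proof (cases "(i, u) = lm R f")
      case True
      then have "fst (lm R f) = i" "snd (lm R f) = u" by (metis fst_conv, metis snd_conv)
      then show ?thesis using monomial_ordering_props(1) u by (auto dest: reflD)
    next
      case False
      then have "((i, u), (fst (lm R f), snd (lm R f))) \<in> R - Id" using le by simp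
      then have "((i, u + v), (fst (lm R f), snd (lm R f) + v)) \<in> R - Id"
        using R unfolding monomial_ordering_def by blast
      then show ?thesis using u by simp
    qed
  qed
qed

text \<open>The leading monomials of \<open>M\<close> are closed under right multiplication by
  words, so their span is already a right submodule, and it contains the generators of
  \<open>LM R M\<close>.\<close>

lemma LM_subset_supported:
  fixes M :: "('x, 'k::field, 'r) free_mod set"
  assumes M: "right_submodule M"
  shows "LM R M \<subseteq> supported (leading R M)"
  unfolding LM_def
proof (rule hull_minimal)
  show "{mono_vec (lm R f) | f. f \<in> M \<and> f \<noteq> 0} \<subseteq> supported (leading R M)"
    by (auto simp: supported_def in_leading_iff)
  have step: "(i, u + v) \<in> leading R M" if "(i, u) \<in> leading R M" for i u v
  proof -
    from that obtain f where f: "f \<in> M" "f \<noteq> 0" "lm R f = (i, u)" by (auto simp: in_leading_iff)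
    have "rmult f (Poly_Mapping.single v 1) \<in> M" using f M by (simp add: right_submodule_def)
    then show ?thesis
      using leading_rmult_single[OF f(2), of v] f(3)
      unfolding in_leading_iff by (metis fst_conv snd_conv)
  qed
  have "rmult f a \<in> supported (leading R M)" if f: "f \<in> supported (leading R M)"
    for f :: "('x, 'k, 'r) free_mod" and a
  proof -
    have "(i, w) \<in> leading R M" if "Poly_Mapping.lookup (f $ i * a) w \<noteq> 0" for i w
    proof -
      \<comment> \<open>Every word of the product extends a word of \<open>f $ i\<close> on the
        right, so closure under single words covers arbitrary multipliers.\<close>
      have "w \<in> Poly_Mapping.keys (f $ i * a)" using that by (simp add: Poly_Mapping.in_keys_iff)
      then obtain u v where "w = u + v" "u \<in> Poly_Mapping.keys (f $ i)"
        using Poly_Mapping.keys_mult by blast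
      moreover from this have "(i, u) \<in> leading R M"
        using f by (auto simp: supported_def monomials_def Poly_Mapping.in_keys_iff)
      ultimately show ?thesis using step by simp
    qed
    then show ?thesis by (auto simp: supported_def monomials_def rmult_def)
  qed
  moreover have "lin_subspace (supported (leading R M) :: ('x, 'k, 'r) free_mod set)"
    by (rule lin_subspace_supported)
  ultimately show "right_submodule (supported (leading R M) :: ('x, 'k, 'r) free_mod set)"
    by (simp add: right_submodule_def lin_subspace_def)
qed

section \<open>Reduction and normal forms\<close>

text \<open>Cancelling the leading term, either by an element of \<open>U\<close> or by a monomial
  that is itself in normal form, makes the leading monomial strictly smaller; well-foundedness ends
  the process.\<close>

lemma normal_form_exists:
  fixes U :: "('x, 'k::field, 'r) free_mod set"
  assumes U: "lin_subspace U" "U \<subseteq> supported D" and f: "f \<in> supported D"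
  shows "\<exists>u\<in>U. \<exists>g\<in>supported (D - leading R U). f = u + g"
proof -
  let ?N = "supported (D - leading R U) :: ('x, 'k, 'r) free_mod set"
  have N: "lin_subspace ?N" by (rule lin_subspace_supported)
  have zero: "\<exists>u\<in>U. \<exists>g\<in>?N. 0 = u + g"
    using U(1) N by (intro bexI[of _ 0]) (auto simp: lin_subspace_def)
  \<comment> \<open>The induction runs over the leading monomial, with \<open>f\<close> quantified
    inside so that the hypothesis applies to the remainder. Zero is treated separately, as it has no
    leading monomial.\<close>
  have reduce: "\<forall>f. f \<in> supported D \<longrightarrow> f \<noteq> 0 \<longrightarrow> lm R f = m \<longrightarrow> (\<exists>u\<in>U. \<exists>g\<in>?N. f = u + g)" for m
  proof (induction m rule: wf_induct_rule[OF monomial_ordering_props(5)])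
    case (1 m)
    show ?case
    proof (intro allI impI)
      fix f :: "('x, 'k, 'r) free_mod"
      assume f: "f \<in> supported D" "f \<noteq> 0" "lm R f = m"
      have mf: "m \<in> monomials f" using lm_props(1) f by blast
      \<comment> \<open>One vector \<open>h\<close> serves both cases: an element of
        \<open>U\<close> with leading monomial \<open>m\<close> if there is one, otherwise the
        monomial \<open>m\<close> itself.\<close>
      obtain h where h: "h \<in> U \<or> h \<in> ?N" "h \<noteq> 0" "lm R h = m"
      proof (cases "m \<in> leading R U")
        case True
        then show ?thesis using that unfolding in_leading_iff by blast
      next
        case False
        show ?thesis
        proof (rule that[of "mono_vec m"])
          show "mono_vec m \<in> U \<or> mono_vec m \<in> ?N"
            using False mf f(1) by (auto simp: supported_def)
        qed (rule mono_vec_nonzero lm_mono_vec)+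
      qed
      have hD: "h \<in> supported D" using h(1) U(2) by (auto simp: supported_def)
      have mh: "m \<in> monomials h" using lm_props(1) h by blast
      \<comment> \<open>The factor makes the coefficients of \<open>f\<close> and \<open>t\<close>
        at \<open>m\<close> agree; the denominator is nonzero because \<open>m\<close> occurs in
        \<open>h\<close>.\<close>
      define t where "t = scale (coeff_at f m / coeff_at h m) h"
      have scaleI: "scale c h \<in> V" if "lin_subspace V" "h \<in> V" for c V
        using that by (simp add: lin_subspace_def)
      have t: "t \<in> U \<or> t \<in> ?N" "t \<in> supported D"
        unfolding t_def using h(1) scaleI[OF U(1)] scaleI[OF N]
          scaleI[OF lin_subspace_supported hD] by blast+
      have rest: "f - t \<in> supported D" using f(1) t(2) by (intro lin_subspace_diff lin_subspace_supported)
      have "\<exists>u\<in>U. \<exists>g\<in>?N. f - t = u + g"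
      proof (cases "f - t = 0")
        case True
        show ?thesis unfolding True by (rule zero)
      next
        case False
        have "m \<notin> monomials (f - t)" using mh by (simp add: in_monomials_iff t_def)
        moreover have "monomials (f - t) \<subseteq> monomials f \<union> monomials h"
          by (auto simp: in_monomials_iff t_def)
        moreover have "lm R (f - t) \<in> monomials (f - t)" by (rule lm_props(1)[OF False])
        ultimately have "lm R (f - t) \<noteq> m" "lm R (f - t) \<in> monomials f \<union> monomials h" by auto
        \<comment> \<open>All monomials of \<open>f\<close> and of \<open>h\<close> are at most
          \<open>m\<close>, and \<open>m\<close> itself has been cancelled.\<close>
        then have "(lm R (f - t), m) \<in> R - Id"
          using lm_props(2)[OF f(2), of "lm R (f - t)"] lm_props(2)[OF h(2), of "lm R (f - t)"] f(3) h(3)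
          by auto
        from 1[OF this] show ?thesis using rest False by blast
      qed
      then obtain u g where ug: "u \<in> U" "g \<in> ?N" "f - t = u + g" by blast
      \<comment> \<open>The subtracted term is returned to whichever summand it came from.\<close>
      from t(1) show "\<exists>u\<in>U. \<exists>g\<in>?N. f = u + g"
      proof
        assume "t \<in> U"
        then have "u + t \<in> U" using ug U(1) by (simp add: lin_subspace_def)
        moreover have "f = (u + t) + g" using ug(3) by (simp add: algebra_simps)
        ultimately show ?thesis using ug(2) by blast
      next
        assume "t \<in> ?N"
        then have "g + t \<in> ?N" using ug N by (simp add: lin_subspace_def)
        moreover have "f = u + (g + t)" using ug(3) by (simp add: algebra_simps)
        ultimately show ?thesis using ug(1) by blast
      qed
    qed
  qed
  show ?thesis
  proof (cases "f = 0")
    case True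
    show ?thesis unfolding True by (rule zero)
  next
    case False
    then show ?thesis using reduce[of "lm R f"] f by blast
  qed
qed

lemma hilbert_function_eq_dim_normal_forms:
  fixes M :: "('x, 'k::field, 'r) free_mod set"
  assumes M: "right_submodule M"
  shows "hilbert_function \<delta> M \<alpha> = vectorspace.dim field_ring
    (vec_space_on (supported (degree_monomials \<delta> \<alpha> - leading R (M \<inter> hom_component \<delta> \<alpha>))
      :: ('x, 'k, 'r) free_mod set))"
  unfolding hilbert_function_def
proof (rule dim_quotient_eq_dim_complement)
  let ?U = "M \<inter> hom_component \<delta> \<alpha>"
  let ?N = "supported (degree_monomials \<delta> \<alpha> - leading R ?U) :: ('x, 'k, 'r) free_mod set"
  show U: "lin_subspace ?U"
    using M by (simp add: hom_component_eq_supported lin_subspace_Int lin_subspace_supported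
        right_submodule_imp_lin_subspace)
  show "?N \<subseteq> hom_component \<delta> \<alpha>" by (auto simp: hom_component_eq_supported supported_def)
  show "vectorspace.fin_dim field_ring (vec_space_on ?N)" by (rule fin_dim_supported) blast
  show N: "lin_subspace ?N" by (rule lin_subspace_supported)
  \<comment> \<open>A nonzero common element would have a leading monomial inside
    \<open>leading R ?U\<close>, while its support avoids that set.\<close>
  have "f = 0" if "f \<in> ?U" "f \<in> ?N" for f
  proof (rule ccontr)
    assume "f \<noteq> 0"
    then show False using that lm_props(1)[of f] by (auto simp: supported_def leading_def)
  qed
  then show "?U \<inter> ?N = {0}" using U N by (auto simp: lin_subspace_def)
  show "\<exists>u\<in>?U. \<exists>v\<in>?N. f = u + v" if "f \<in> hom_component \<delta> \<alpha>" for f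
    using normal_form_exists[OF U] that by (auto simp: hom_component_eq_supported)
qed blast

section \<open>Comparing the leading monomials of M and LM(M) degree by degree\<close>

text \<open>A monomial occurring in \<open>LM R M\<close> is the leading monomial of some
  \<open>g\<close> in \<open>M\<close>, possibly inhomogeneous. As \<open>M\<close> is multigraded,
  the component of \<open>g\<close> in the degree of that monomial stays in \<open>M\<close> and has
  the same leading monomial.\<close>

lemma leading_component:
  fixes M :: "('x, 'k::field, 'r) free_mod set"
  assumes M: "right_submodule M" "multigraded \<delta> M"
  shows "leading R (LM R M \<inter> hom_component \<delta> \<alpha>) = leading R (M \<inter> hom_component \<delta> \<alpha>)"
proof
  show "leading R (M \<inter> hom_component \<delta> \<alpha>) \<subseteq> leading R (LM R M \<inter> hom_component \<delta> \<alpha>)"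
  proof
    fix m assume "m \<in> leading R (M \<inter> hom_component \<delta> \<alpha>)"
    then obtain f where f: "f \<in> M" "f \<in> hom_component \<delta> \<alpha>" "f \<noteq> 0" "m = lm R f"
      by (auto simp: in_leading_iff)
    \<comment> \<open>The leading monomial itself is the witness: it is a generator of
      \<open>LM R M\<close>, inherits the degree of \<open>f\<close>, and leads itself.\<close>
    let ?e = "mono_vec m :: ('x, 'k, 'r) free_mod"
    have "?e \<in> LM R M" unfolding LM_def f(4) using f by (intro hull_inc) blast
    moreover have "?e \<in> hom_component \<delta> \<alpha>"
      using lm_props(1)[OF f(3)] f(2,4)
      by (auto simp: hom_component_eq_supported supported_def)
    ultimately show "m \<in> leading R (LM R M \<inter> hom_component \<delta> \<alpha>)"
      unfolding leading_def by (intro image_eqI[of _ _ ?e]) (auto simp: lm_mono_vec mono_vec_nonzero)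
  qed
  show "leading R (LM R M \<inter> hom_component \<delta> \<alpha>) \<subseteq> leading R (M \<inter> hom_component \<delta> \<alpha>)"
  proof
    fix m assume "m \<in> leading R (LM R M \<inter> hom_component \<delta> \<alpha>)"
    then obtain f where f: "f \<in> LM R M" "f \<in> hom_component \<delta> \<alpha>" "f \<noteq> 0" "m = lm R f"
      by (auto simp: in_leading_iff)
    have mf: "m \<in> monomials f" using f lm_props(1) by simp
    have m\<alpha>: "m \<in> degree_monomials \<delta> \<alpha>"
      using mf f(2) by (auto simp: hom_component_eq_supported supported_def)
    have "m \<in> leading R M" using mf f(1) LM_subset_supported[OF M(1)] by (auto simp: supported_def)
    then obtain g where g: "g \<in> M" "g \<noteq> 0" "lm R g = m" by (auto simp: in_leading_iff)
    obtain A p where p: "g = sum p A" "finite A" "\<forall>\<beta>\<in>A. p \<beta> \<in> M \<inter> hom_component \<delta> \<beta>"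
      using g(1) M(2) unfolding multigraded_def by blast
    \<comment> \<open>Different degrees share no monomials, so in degree \<alpha> only the summand
      \<open>p \<alpha>\<close> contributes. If \<alpha> is not an index the coefficient is zero,
      which is excluded below because \<open>m\<close> occurs in \<open>g\<close>.\<close>
    have coeff: "coeff_at g m' = (if \<alpha> \<in> A then coeff_at (p \<alpha>) m' else 0)"
      if m': "m' \<in> degree_monomials \<delta> \<alpha>" for m'
    proof -
      have "coeff_at (p \<beta>) m' = 0" if "\<beta> \<in> A" "\<beta> \<noteq> \<alpha>" for \<beta>
      proof (rule ccontr)
        assume "coeff_at (p \<beta>) m' \<noteq> 0"
        then have "m' \<in> monomials (p \<beta>)" by (simp add: in_monomials_iff)
        then have "m' \<in> degree_monomials \<delta> \<beta>"
          using p(3) that by (auto simp: hom_component_eq_supported supported_def)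
        then show False using m' that by (auto simp: degree_monomials_def)
      qed
      then have "(\<Sum>\<beta>\<in>A. coeff_at (p \<beta>) m') = (\<Sum>\<beta>\<in>A. if \<beta> = \<alpha> then coeff_at (p \<alpha>) m' else 0)"
        by (intro sum.cong) auto
      then show ?thesis using p(1,2) by simp
    qed
    have mg: "m \<in> monomials g" using g lm_props(1) by blast
    have \<alpha>: "\<alpha> \<in> A" using coeff[OF m\<alpha>] mg by (auto simp: in_monomials_iff split: if_splits)
    have mp: "m \<in> monomials (p \<alpha>)" using coeff[OF m\<alpha>] mg \<alpha> by (simp add: in_monomials_iff)
    \<comment> \<open>Within a smaller support that still contains \<open>m\<close>, the greatest
      monomial remains \<open>m\<close>.\<close>
    have "monomials (p \<alpha>) \<subseteq> monomials g"
    proof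
      fix m' assume m': "m' \<in> monomials (p \<alpha>)"
      then have "m' \<in> degree_monomials \<delta> \<alpha>"
        using p(3) \<alpha> by (auto simp: hom_component_eq_supported supported_def)
      then show "m' \<in> monomials g" using coeff[of m'] m' \<alpha> by (simp add: in_monomials_iff)
    qed
    then have "lm R (p \<alpha>) = m" using mp lm_props(2)[OF g(2)] g(3) by (intro lm_eqI) auto
    moreover have "p \<alpha> \<noteq> 0" using mp monomials_empty_iff by blast
    ultimately show "m \<in> leading R (M \<inter> hom_component \<delta> \<alpha>)"
      using p(3) \<alpha> unfolding leading_def by (intro image_eqI[of _ _ "p \<alpha>"]) auto
  qed
qed

end

theorem theorem3p2:
  fixes \<delta> :: "(nat ^ 'x::finite) ^ 'r::finite"
    and M :: "('x, 'k::field, 'r) free_mod set"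
    and R :: "('r \<times> 'x word) rel"
  assumes "right_submodule M"
    and "multigraded \<delta> M"
    and "monomial_ordering R"
  shows "hilbert_function \<delta> M = hilbert_function \<delta> (LM R M)
    \<and> hilbert_series \<delta> M = hilbert_series \<delta> (LM R M)"
proof -
  \<comment> \<open>Both values are dimensions of normal-form spaces, and equal leading sets in
    degree \<alpha> make these the same space.\<close>
  have "hilbert_function \<delta> M \<alpha> = hilbert_function \<delta> (LM R M) \<alpha>" for \<alpha>
    using assms by (simp add: hilbert_function_eq_dim_normal_forms[of R] right_submodule_LM
        leading_component)
  then show ?thesis by (auto simp: hilbert_series_def)
qed

end
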